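(* Let $q>1$, $\mathcal{Q}=\{q^n:n\in\mathbb{N}_0\}$, $a\in\mathcal{Q}$ and $f,g:[a,+\infty[\rightarrow\mathbb{R}$. If $$\lim_{T\to+\infty}\inf_{T'\ge T}\int_a^{T'}\left(f(t)\,\eta(qt)+g(t)\,D_q[\eta](t)\right)d_qt=0$$ for all $\eta:[a,+\infty[\rightarrow\mathbb{R}$ such that $\eta(a)=0$, then $D_q[g](t)=f(t)$ for all $t\in[a,+\infty[$.
   Context: Here $q>1$ is a fixed real, $\mathcal{Q}=\{q^n:n\in\mathbb{N}_0\}$, and intervals are $q$-intervals: $[a,+\infty[=\{t\in\mathcal{Q}:t\ge a\}$. The Jackson $q$-difference operator is $D_q[f](t)=\frac{f(qt)-f(t)}{(q-1)t}$. For $b=aq^n$ ($n\in\mathbb{N}_0$), $\int_a^bf(t)\,d_qt=a(q-1)\sum_{k=0}^{n-1}q^kf(aq^k)$. In $\lim_{T\to+\infty}\inf_{T'\ge T}$, $T$ and $T'$ range over elements of $\mathcal{Q}$ with $T'\ge T>a$, and infima and limits are taken in $\overline{\mathbb{R}}=\mathbb{R}\cup\{\pm\infty\}$. *)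

theory Defs
  imports "HOL-Analysis.Analysis"
begin

definition q_powers :: "real \<Rightarrow> real set" where
  "q_powers q = {q ^ n | n :: nat. True}"

definition q_atLeast :: "real \<Rightarrow> real \<Rightarrow> real set" where
  "q_atLeast q a = {t \<in> q_powers q. a \<le> t}"

definition q_greaterThan :: "real \<Rightarrow> real \<Rightarrow> real set" where
  "q_greaterThan q a = {t \<in> q_powers q. a < t}"

definition q_diff :: "real \<Rightarrow> (real \<Rightarrow> real) \<Rightarrow> real \<Rightarrow> real" where
  "q_diff q f t = (f (q * t) - f t) / ((q - 1) * t)"

(* Only meaningful when b = a * q ^ n for a (then unique) natural number n. *)
definition q_integral :: "real \<Rightarrow> real \<Rightarrow> real \<Rightarrow> (real \<Rightarrow> real) \<Rightarrow> real" where
  "q_integral q a b f =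
     (let n = (THE n :: nat. b = a * q ^ n)
      in a * (q - 1) * (\<Sum>k<n. q ^ k * f (a * q ^ k)))"

lemma q_integral_power:
  assumes "q > 1" and "a > 0"
  shows "q_integral q a (a * q ^ n) f = a * (q - 1) * (\<Sum>k<n. q ^ k * f (a * q ^ k))"
proof -
  have "(THE m :: nat. a * q ^ n = a * q ^ m) = n"
    using assms by (intro the_equality) auto
  then show ?thesis by (simp add: q_integral_def)
qed

(* T tends to infinity through the powers of q exceeding a. *)
definition q_at_top :: "real \<Rightarrow> real \<Rightarrow> real filter" where
  "q_at_top q a = inf at_top (principal (q_greaterThan q a))"

end

theory Submission
  imports Defs
begin

text \<open>
  The test functions may be as concentrated as one likes. For \<open>t = a q\<^sup>m\<close>, take \<open>\<eta>\<close> to be the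
  indicator of the single point \<open>q t\<close>, which differs from \<open>a\<close>. Then \<open>\<eta>(q s)\<close> is nonzero only at
  \<open>s = t\<close> and \<open>D\<^sub>q[\<eta>]\<close> only at \<open>t\<close> and \<open>q t\<close>, so once the upper limit lies beyond \<open>q t\<close> the
  integral no longer depends on it: it equals \<open>(q - 1) t f(t) + g(t) - g(q t)\<close>
  (\<open>q_integral_point_variation\<close>). The lower limit of an eventually constant quantity is that
  constant, so the constant vanishes, and dividing by \<open>(q - 1) t\<close> gives \<open>D\<^sub>q[g](t) = f(t)\<close>.
\<close>

lemma q_powers_pos:
  assumes "q > 1" and "a \<in> q_powers q"
  shows "a > 0"
  using assms by (auto simp: q_powers_def)

lemma q_powers_geE:
  assumes "q > 1" and "a \<in> q_powers q" and "t \<in> q_powers q" and "a * q ^ m \<le> t"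
  obtains n where "m \<le> n" and "t = a * q ^ n"
proof -
  from assms(2,3) obtain i j where i: "a = q ^ i" and j: "t = q ^ j"
    by (auto simp: q_powers_def)
  from assms(4) have "q ^ (i + m) \<le> q ^ j"
    by (simp add: i j power_add)
  with \<open>q > 1\<close> have "i + m \<le> j"
    by simp
  then show thesis
    by (intro that[of "j - i"]) (auto simp: i j simp flip: power_add)
qed

text \<open>Nontriviality of the filter is what makes its limits unique.\<close>

lemma q_at_top_neq_bot:
  assumes "q > 1"
  shows "q_at_top q a \<noteq> bot"
proof -
  have "\<exists>x\<ge>b. x \<in> q_greaterThan q a" for b
  proof -
    obtain n where "max a b < q ^ n"
      using real_arch_pow[OF assms] by blast
    then show ?thesis
      by (intro exI[of _ "q ^ n"]) (auto simp: q_greaterThan_def q_powers_def)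
  qed
  then show ?thesis
    unfolding q_at_top_def trivial_limit_def eventually_inf_principal eventually_at_top_linorder
    by blast
qed

lemma eventually_q_at_top_ge:
  "\<forall>\<^sub>F T in q_at_top q a. b \<le> T \<and> T \<in> q_powers q"
  unfolding q_at_top_def eventually_inf_principal
  by (rule eventually_mono[OF eventually_ge_at_top[of b]]) (auto simp: q_greaterThan_def)

text \<open>
  The weight \<open>a (q - 1) q\<^sup>k\<close> of the integral cancels the denominator of \<open>D\<^sub>q\<close> at \<open>a q\<^sup>k\<close>, so \<open>g\<close>
  enters through a plain difference. The node \<open>a q\<^bsup>m+1\<^esup>\<close> must be among the summation points, hence
  \<open>m + 2 \<le> n\<close>.
\<close>

lemma q_integral_point_variation:
  fixes f g :: "real \<Rightarrow> real"
  assumes "q > 1" and "a > 0" and "m + 2 \<le> n"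
  defines "\<eta> \<equiv> \<lambda>x. if x = a * q ^ Suc m then 1 else 0"
  shows "q_integral q a (a * q ^ n) (\<lambda>t. f t * \<eta> (q * t) + g t * q_diff q \<eta> t) =
    (q - 1) * (a * q ^ m) * f (a * q ^ m) + g (a * q ^ m) - g (a * q ^ Suc m)"
proof -
  have node: "\<eta> (a * q ^ k) = of_bool (k = Suc m)" for k
    using assms(1,2) power_inject_exp[of q k "Suc m"] by (simp add: \<eta>_def del: power_Suc)
  have shift: "\<eta> (q * (a * q ^ k)) = of_bool (k = m)" for k
    using node[of "Suc k"] by (simp add: mult.left_commute)
  have summand: "a * (q - 1) * (q ^ k * (f (a * q ^ k) * \<eta> (q * (a * q ^ k))
        + g (a * q ^ k) * q_diff q \<eta> (a * q ^ k))) =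
      (if k = m then (q - 1) * (a * q ^ m) * f (a * q ^ m) + g (a * q ^ m) else 0)
      + (if k = Suc m then - g (a * q ^ Suc m) else 0)" for k
    using assms(1,2) unfolding q_diff_def node shift
    by (auto simp: field_simps)
  show ?thesis
    unfolding q_integral_power[OF assms(1,2)] sum_distrib_left summand sum.distrib
    using assms(3) by (simp add: sum.delta')
qed

theorem lemma6:
  fixes q a :: real and f g :: "real \<Rightarrow> real"
  assumes "q > 1"
    and "a \<in> q_powers q"
    and "\<And>\<eta> :: real \<Rightarrow> real. \<eta> a = 0 \<Longrightarrow>
      ((\<lambda>T. INF T' \<in> q_atLeast q T.
          ereal (q_integral q a T' (\<lambda>t. f t * \<eta> (q * t) + g t * q_diff q \<eta> t)))
        \<longlongrightarrow> 0) (q_at_top q a)"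
  shows "\<forall>t \<in> q_atLeast q a. q_diff q g t = f t"
proof
  fix t assume "t \<in> q_atLeast q a"
  then obtain m where t: "t = a * q ^ m"
    using q_powers_geE[OF assms(1,2), of t 0] by (auto simp: q_atLeast_def)
  have "a > 0"
    using assms(1,2) by (rule q_powers_pos)
  define \<eta> :: "real \<Rightarrow> real" where "\<eta> = (\<lambda>x. if x = a * q ^ Suc m then 1 else 0)"
  define c where "c = (q - 1) * t * f t + g t - g (q * t)"
  let ?I = "\<lambda>T'. q_integral q a T' (\<lambda>t. f t * \<eta> (q * t) + g t * q_diff q \<eta> t)"
  have const: "?I T' = c" if T': "T' \<in> q_powers q" "a * q ^ (m + 2) \<le> T'" for T'
  proof -
    obtain n where "m + 2 \<le> n" "T' = a * q ^ n"
      using q_powers_geE[OF assms(1,2) T'] .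
    then show ?thesis
      using q_integral_point_variation[OF assms(1) \<open>a > 0\<close>, of m n f g]
      by (simp add: \<eta>_def c_def t mult.left_commute)
  qed
  have "\<forall>\<^sub>F T in q_at_top q a. (INF T' \<in> q_atLeast q T. ereal (?I T')) = ereal c"
    using eventually_q_at_top_ge[of "a * q ^ (m + 2)"]
  proof eventually_elim
    case (elim T)
    \<comment> \<open>The infimum over an empty set would be \<open>\<infinity>\<close>, so \<open>T\<close> itself has to be a power of \<open>q\<close>.\<close>
    then have "T \<in> q_atLeast q T"
      by (simp add: q_atLeast_def)
    moreover have "ereal (?I T') = ereal c" if "T' \<in> q_atLeast q T" for T'
      using that elim const[of T'] by (auto simp: q_atLeast_def)
    ultimately show ?case
      by (intro INF_eq_const) auto
  qed
  then have "((\<lambda>T. INF T' \<in> q_atLeast q T. ereal (?I T')) \<longlongrightarrow> ereal c) (q_at_top q a)"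
    by (rule tendsto_eventually)
  moreover have "\<eta> a = 0"
    using assms(1) \<open>a > 0\<close> one_less_power[OF assms(1), of "Suc m"] by (auto simp: \<eta>_def)
  ultimately have "ereal c = 0"
    using tendsto_unique[OF q_at_top_neq_bot[OF assms(1)]] assms(3) by blast
  then have "g (q * t) - g t = (q - 1) * t * f t"
    by (simp add: c_def)
  moreover have "(q - 1) * t \<noteq> 0"
    using assms(1) \<open>a > 0\<close> by (simp add: t)
  ultimately show "q_diff q g t = f t"
    by (simp add: q_diff_def)
qed

end
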